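(* Let $\mathcal{O}$ be a set of admissible domains $\Omega\subset\mathbb{R}^3$ and suppose that for each $\Omega\in\mathcal{O}$ the crack initiation process $\gamma=\gamma(\Omega)$ is a Poisson point process on $[0,\infty)\times\bar\Omega$ with intensity measure $$\rho(\Omega,C)=\int_{C\cap(\mathbb{R}\times\Omega)}\varrho_{vol}(t,x,T,\nabla T,u,\nabla u,\nabla^2u,\nabla^3u)\,dt\,dx+\int_{C\cap(\mathbb{R}\times\partial\Omega)}\varrho_{sur}(t,x,T,\nabla T,u,\nabla u,\nabla^2u,\nabla^3u)\,dt\,dA .$$ Put $\mathcal{F}_{vol/sur}(t,\cdot)=\int_0^t\varrho_{vol/sur}(s,\cdot)\,ds$ and $$\mathcal{J}_t(\Omega,u,T)=\int_\Omega\mathcal{F}_{vol}(t,x,T,\nabla T,u,\nabla u,\nabla^2u,\nabla^3u)\,dx+\int_{\partial\Omega}\mathcal{F}_{sur}(t,x,T,\nabla T,u,\nabla u,\nabla^2u,\nabla^3u)\,dA .$$ (i) A shape $\Omega^*\in\mathcal{O}$ solves the optimal reliability problem at fixed time $t\in\mathbb{R}_+$ if and only if $$\mathcal{J}_t(\Omega^*,u,T)\le\mathcal{J}_t(\Omega,u,T)\quad\forall\,\Omega\in\mathcal{O}.\qquad(\ast)$$ (ii) A shape $\Omega^*\in\mathcal{O}$ solves the optimal reliability problem in the sense of first order stochastic dominance if and only if $\Omega^*$ satisfies $(\ast)$ for all $t\in\mathbb{R}_+$. (iii) A shape $\Omega^*\in\mathcal{O}$ solves the optimal reliability problem in the sense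 of instantaneous hazard if and only if $$\frac{d\mathcal{J}_t(\Omega^*,u,T)}{dt}\le\frac{d\mathcal{J}_t(\Omega,u,T)}{dt}\quad\forall\,t\in\mathbb{R}_+,\ \Omega\in\mathcal{O}.$$
   Context: Each $\Omega\in\mathcal{O}$ is a bounded domain with associated temperature field $T=T(\Omega):\bar\Omega\to\mathbb{R}$ and displacement field $u=u(\Omega):\bar\Omega\to\mathbb{R}^3$; in $\mathcal{J}_t(\Omega,u,T)$ it is understood that $u=u(\Omega)$, $T=T(\Omega)$. $dA$ is surface measure, $\varrho_{vol},\varrho_{sur}\ge0$, and $\rho(\Omega,\cdot)$ is a Radon measure. A Poisson point process with intensity $\rho$ is a random Radon counting measure $\gamma$ with independent increments on disjoint Borel sets and $\gamma(C)$ Poisson distributed with mean $\rho(C)$. The first failure time is $\tau=\tau(\Omega)=\inf\{t\ge0:\gamma([0,t]\times\bar\Omega)>0\}$, with distribution function $F_{\tau(\Omega)}(t)=P(\tau(\Omega)\le t)$. Notions of reliability, for two designs $\Omega,\Omega'$ with first failure times $\tau,\tau'$: (i) $\Omega$ is more or equally reliable than $\Omega'$ at fixed time $t$ if $F_\tau(t)\le F_{\tau'}(t)$; (ii) $\Omega$ is more or equally reliable in first stochastic order (first order stochastic dominance) if $F_\tau(t)\le F_{\tau'}(t)$ for all $t\in\mathbb{R}_+$; (iii) if $\tau,\tau'$ are continuously distributed, $\Omega$ is more reliable in the sense of instantaneous hazard if $h_\tau(t)\le h_{\tau'}(t)$ for all $t\ge0$, where $h_\tau(t)=f_\tau(t)/(1-F_\tau(t))$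 is the hazard rate and $f_\tau$ the density of $\tau$. A shape $\Omega^*\in\mathcal{O}$ solves the optimal reliability problem in one of these senses if it is more or equally reliable, in that sense, than every $\Omega\in\mathcal{O}$. *)

theory Defs
  imports "HOL-Probability.Probability"
begin

section \<open>Surface measure\<close>

text \<open>
  The surface measure \<open>dA\<close> is the two-dimensional Hausdorff measure, normalised by the factor
  \<open>\<pi>/4\<close> so that it is Lebesgue area on planes and the classical surface measure on
  \<open>C\<^sup>1\<close> (or Lipschitz) surfaces.
\<close>

definition hausdorff2_pre :: "real \<Rightarrow> 'a::metric_space set \<Rightarrow> ennreal" where
  "hausdorff2_pre \<delta> A =
     (INF C\<in>{C :: nat \<Rightarrow> 'a set. A \<subseteq> (\<Union>i. C i) \<and> (\<forall>i. bounded (C i) \<and> diameter (C i) \<le> \<delta>)}.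
        \<Sum>i. ennreal (pi / 4 * (diameter (C i))\<^sup>2))"

definition hausdorff2_outer :: "'a::metric_space set \<Rightarrow> ennreal" where
  "hausdorff2_outer A = (SUP \<delta>\<in>{0<..}. hausdorff2_pre \<delta> A)"

definition hausdorff2 :: "'a::metric_space measure" where
  "hausdorff2 = measure_of UNIV (sets borel) hausdorff2_outer"

text \<open>
  The constant \<^const>\<open>measure_of\<close> yields the null measure when its argument is not countably
  additive; the next lemmas show that this does not happen here, so that \<open>hausdorff2\<close> agrees
  with the outer measure on all Borel sets.
\<close>

definition hausdorff2_gauge :: "real \<Rightarrow> 'a::metric_space set \<Rightarrow> ennreal" where
  "hausdorff2_gauge \<delta> S =
     (if bounded S \<and> diameter S \<le> \<delta> then ennreal (pi / 4 * (diameter S)\<^sup>2) else \<infinity>)"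

lemma hausdorff2_gauge_mono:
  assumes "S \<subseteq> T" shows "hausdorff2_gauge \<delta> S \<le> hausdorff2_gauge \<delta> T"
proof (cases "bounded T \<and> diameter T \<le> \<delta>")
  case True
  then have "bounded S" "diameter S \<le> diameter T"
    using assms bounded_subset diameter_subset by blast+
  moreover have "0 \<le> diameter S"
    using \<open>bounded S\<close> by (rule diameter_ge_0)
  ultimately show ?thesis
    using True by (auto simp: hausdorff2_gauge_def intro!: ennreal_leI power_mono mult_left_mono)
qed (auto simp: hausdorff2_gauge_def)

lemma hausdorff2_gauge_empty: "0 \<le> \<delta> \<Longrightarrow> hausdorff2_gauge \<delta> {} = 0"
  by (simp add: hausdorff2_gauge_def)

lemma hausdorff2_pre_le_gauge:
  assumes "A \<subseteq> (\<Union>i. C i)"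
  shows "hausdorff2_pre \<delta> A \<le> (\<Sum>i. hausdorff2_gauge \<delta> (C i))"
proof (cases "\<forall>i. bounded (C i) \<and> diameter (C i) \<le> \<delta>")
  case True
  then have "(\<Sum>i. hausdorff2_gauge \<delta> (C i)) = (\<Sum>i. ennreal (pi / 4 * (diameter (C i))\<^sup>2))"
    by (simp add: hausdorff2_gauge_def)
  then show ?thesis
    using assms True by (auto simp: hausdorff2_pre_def intro!: INF_lower2[where i=C])
next
  case False
  then obtain i where "\<not> (bounded (C i) \<and> diameter (C i) \<le> \<delta>)" by blast
  then have "hausdorff2_gauge \<delta> (C i) = \<infinity>"
    by (simp only: hausdorff2_gauge_def if_False)
  moreover have "hausdorff2_gauge \<delta> (C i) \<le> (\<Sum>i. hausdorff2_gauge \<delta> (C i))"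
    using sum_le_suminf[OF summableI, of "{i}" "\<lambda>i. hausdorff2_gauge \<delta> (C i)"] by simp
  ultimately show ?thesis by (simp add: top_unique)
qed

lemma hausdorff2_pre_geI:
  assumes "\<And>C. A \<subseteq> (\<Union>i. C i) \<Longrightarrow> (\<forall>i. bounded (C i) \<and> diameter (C i) \<le> \<delta>) \<Longrightarrow>
             x \<le> (\<Sum>i. hausdorff2_gauge \<delta> (C i))"
  shows "x \<le> hausdorff2_pre \<delta> A"
  unfolding hausdorff2_pre_def
proof (rule INF_greatest, clarify)
  fix C :: "nat \<Rightarrow> 'a set"
  assume C: "A \<subseteq> (\<Union>i. C i)" "\<forall>i. bounded (C i) \<and> diameter (C i) \<le> \<delta>"
  then have "(\<Sum>i. hausdorff2_gauge \<delta> (C i)) = (\<Sum>i. ennreal (pi / 4 * (diameter (C i))\<^sup>2))"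
    by (simp add: hausdorff2_gauge_def)
  with assms[OF C] show "x \<le> (\<Sum>i. ennreal (pi / 4 * (diameter (C i))\<^sup>2))" by simp
qed

lemma hausdorff2_pre_eq_outer_measure:
  assumes "0 < \<delta>"
  shows "hausdorff2_pre \<delta> A = outer_measure UNIV (hausdorff2_gauge \<delta>) A"
proof (rule antisym)
  show "hausdorff2_pre \<delta> A \<le> outer_measure UNIV (hausdorff2_gauge \<delta>) A"
    unfolding outer_measure_def by (rule INF_greatest) (auto intro: hausdorff2_pre_le_gauge)
  have "sigma_algebra UNIV (UNIV :: 'a set set)"
    using sigma_algebra_Pow[of "UNIV :: 'a set"] by simp
  then interpret sigma_algebra UNIV "UNIV :: 'a set set" .
  show "outer_measure UNIV (hausdorff2_gauge \<delta>) A \<le> hausdorff2_pre \<delta> A"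
    using assms by (intro hausdorff2_pre_geI outer_measure_le)
      (auto simp: positive_def increasing_def hausdorff2_gauge_empty intro: hausdorff2_gauge_mono)
qed

lemma outer_measure_space_hausdorff2_pre:
  assumes "0 < \<delta>"
  shows "outer_measure_space UNIV (hausdorff2_pre \<delta> :: 'a::metric_space set \<Rightarrow> ennreal)"
proof -
  have "sigma_algebra UNIV (UNIV :: 'a set set)"
    using sigma_algebra_Pow[of "UNIV :: 'a set"] by simp
  then interpret sigma_algebra UNIV "UNIV :: 'a set set" .
  have "outer_measure_space (Pow UNIV) (outer_measure UNIV (hausdorff2_gauge \<delta> :: 'a set \<Rightarrow> _))"
    using assms by (intro outer_measure_space_outer_measure)
      (auto simp: positive_def increasing_def hausdorff2_gauge_empty intro: hausdorff2_gauge_mono)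
  moreover have "hausdorff2_pre \<delta> = outer_measure UNIV (hausdorff2_gauge \<delta> :: 'a set \<Rightarrow> _)"
    using hausdorff2_pre_eq_outer_measure[OF assms] by (rule ext)
  ultimately show ?thesis by simp
qed

lemma hausdorff2_pre_antimono:
  assumes "0 < \<delta>" "\<delta> \<le> \<delta>'"
  shows "hausdorff2_pre \<delta>' A \<le> hausdorff2_pre \<delta> A"
  unfolding hausdorff2_pre_def
proof (rule INF_superset_mono)
  show "{C. A \<subseteq> (\<Union>i. C i) \<and> (\<forall>i. bounded (C i) \<and> diameter (C i) \<le> \<delta>)}
      \<subseteq> {C. A \<subseteq> (\<Union>i. C i) \<and> (\<forall>i. bounded (C i) \<and> diameter (C i) \<le> \<delta>')}"
    using assms by (auto intro: order_trans)
qed simp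

lemma outer_measure_space_hausdorff2:
  "outer_measure_space UNIV (hausdorff2_outer :: 'a::metric_space set \<Rightarrow> ennreal)"
  unfolding outer_measure_space_def
proof (intro conjI)
  have oms: "outer_measure_space UNIV (hausdorff2_pre \<delta> :: 'a set \<Rightarrow> ennreal)" if "0 < \<delta>" for \<delta>
    using that by (rule outer_measure_space_hausdorff2_pre)
  show "positive UNIV (hausdorff2_outer :: 'a set \<Rightarrow> ennreal)"
    using oms by (auto simp: positive_def outer_measure_space_def hausdorff2_outer_def
      intro!: antisym SUP_least)
  show "increasing UNIV (hausdorff2_outer :: 'a set \<Rightarrow> ennreal)"
    using oms by (auto simp: increasing_def outer_measure_space_def hausdorff2_outer_def
      intro!: SUP_mono)
  show "countably_subadditive UNIV (hausdorff2_outer :: 'a set \<Rightarrow> ennreal)"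
    unfolding countably_subadditive_def
  proof (intro allI impI)
    fix A :: "nat \<Rightarrow> 'a set" assume A: "disjoint_family A"
    have "hausdorff2_pre \<delta> (\<Union>i. A i) \<le> (\<Sum>i. hausdorff2_outer (A i))" if "0 < \<delta>" for \<delta>
    proof -
      have "hausdorff2_pre \<delta> (\<Union>i. A i) \<le> (\<Sum>i. hausdorff2_pre \<delta> (A i))"
        using oms[OF that] A by (auto simp: outer_measure_space_def countably_subadditive_def)
      also have "\<dots> \<le> (\<Sum>i. hausdorff2_outer (A i))"
        using that by (intro suminf_le) (auto simp: hausdorff2_outer_def intro!: SUP_upper)
      finally show ?thesis .
    qed
    then show "hausdorff2_outer (\<Union>i. A i) \<le> (\<Sum>i. hausdorff2_outer (A i))"
      by (subst hausdorff2_outer_def) (auto intro!: SUP_least)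
  qed
qed

lemma hausdorff2_outer_mono: "A \<subseteq> B \<Longrightarrow> hausdorff2_outer A \<le> hausdorff2_outer B"
  using outer_measure_space_hausdorff2 by (auto simp: outer_measure_space_def increasing_def)

lemma hausdorff2_outer_empty [simp]: "hausdorff2_outer {} = 0"
  using outer_measure_space_hausdorff2 by (auto simp: outer_measure_space_def positive_def)

lemma hausdorff2_outer_Un: "hausdorff2_outer (A \<union> B) \<le> hausdorff2_outer A + hausdorff2_outer B"
proof -
  interpret sigma_algebra UNIV "UNIV :: 'a set set"
    using sigma_algebra_Pow[of "UNIV :: 'a set"] by simp
  have "subadditive UNIV (hausdorff2_outer :: 'a set \<Rightarrow> ennreal)"
    using outer_measure_space_hausdorff2
    by (auto simp: outer_measure_space_def intro: countably_subadditive_subadditive)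
  then have "hausdorff2_outer (A \<union> (B - A)) \<le> hausdorff2_outer A + hausdorff2_outer (B - A)"
    by (intro subadditiveD[where M=UNIV]) auto
  also have "\<dots> \<le> hausdorff2_outer A + hausdorff2_outer B"
    by (intro add_left_mono hausdorff2_outer_mono) auto
  finally show ?thesis by simp
qed

lemma hausdorff2_outer_UN: "hausdorff2_outer (\<Union>i. A i) \<le> (\<Sum>i::nat. hausdorff2_outer (A i))"
proof -
  have "hausdorff2_outer (\<Union>i. disjointed A i) \<le> (\<Sum>i. hausdorff2_outer (disjointed A i))"
    using outer_measure_space_hausdorff2 disjoint_family_disjointed[of A]
    by (auto simp: outer_measure_space_def countably_subadditive_def)
  also have "\<dots> \<le> (\<Sum>i. hausdorff2_outer (A i))"
    by (intro suminf_le hausdorff2_outer_mono disjointed_subset) auto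
  finally show ?thesis by (simp add: UN_disjointed_eq)
qed

lemma hausdorff2_outer_separated:
  fixes A B :: "'a::metric_space set"
  assumes d: "0 < d" and sep: "\<And>a b. a \<in> A \<Longrightarrow> b \<in> B \<Longrightarrow> d \<le> dist a b"
  shows "hausdorff2_outer A + hausdorff2_outer B \<le> hausdorff2_outer (A \<union> B)"
proof -
  have pre: "hausdorff2_pre \<delta> A + hausdorff2_pre \<delta> B \<le> hausdorff2_pre \<delta> (A \<union> B)"
    if "0 < \<delta>" "\<delta> < d" for \<delta>
  proof (rule hausdorff2_pre_geI)
    fix C :: "nat \<Rightarrow> 'a set" assume C: "A \<union> B \<subseteq> (\<Union>i. C i)" "\<forall>i. bounded (C i) \<and> diameter (C i) \<le> \<delta>"
    have "hausdorff2_gauge \<delta> (C i \<inter> A) + hausdorff2_gauge \<delta> (C i \<inter> B) \<le> hausdorff2_gauge \<delta> (C i)"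
      for i :: nat
    proof -
      have "C i \<inter> A = {} \<or> C i \<inter> B = {}"
      proof (rule ccontr)
        assume "\<not> ?thesis"
        then obtain a b where "a \<in> C i" "a \<in> A" "b \<in> C i" "b \<in> B" by auto
        then have "dist a b \<le> diameter (C i)" "diameter (C i) \<le> \<delta>" "d \<le> dist a b"
          using C(2) diameter_bounded_bound[of "C i" a b] sep by auto
        with that show False by simp
      qed
      then show ?thesis
        using that by (auto simp: hausdorff2_gauge_empty intro: hausdorff2_gauge_mono)
    qed
    then have "(\<Sum>i. hausdorff2_gauge \<delta> (C i \<inter> A) + hausdorff2_gauge \<delta> (C i \<inter> B))
        \<le> (\<Sum>i. hausdorff2_gauge \<delta> (C i))"
      by (intro suminf_le) auto
    moreover have "hausdorff2_pre \<delta> A + hausdorff2_pre \<delta> B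
        \<le> (\<Sum>i. hausdorff2_gauge \<delta> (C i \<inter> A)) + (\<Sum>i. hausdorff2_gauge \<delta> (C i \<inter> B))"
      using C(1) by (intro add_mono hausdorff2_pre_le_gauge) auto
    ultimately show "hausdorff2_pre \<delta> A + hausdorff2_pre \<delta> B \<le> (\<Sum>i. hausdorff2_gauge \<delta> (C i))"
      by (simp add: suminf_add[symmetric])
  qed
  have "hausdorff2_pre \<delta> A + hausdorff2_pre \<delta>' B \<le> hausdorff2_outer (A \<union> B)"
    if "0 < \<delta>" "0 < \<delta>'" for \<delta> \<delta>'
  proof -
    define e where "e = min (min \<delta> \<delta>') (d / 2)"
    have e: "0 < e" "e \<le> \<delta>" "e \<le> \<delta>'" "e < d" using that d by (auto simp: e_def)
    have "hausdorff2_pre \<delta> A + hausdorff2_pre \<delta>' B \<le> hausdorff2_pre e A + hausdorff2_pre e B"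
      using e by (intro add_mono hausdorff2_pre_antimono)
    also have "\<dots> \<le> hausdorff2_pre e (A \<union> B)" using e by (intro pre)
    also have "\<dots> \<le> hausdorff2_outer (A \<union> B)"
      using e by (auto simp: hausdorff2_outer_def intro: SUP_upper)
    finally show ?thesis .
  qed
  then have "hausdorff2_pre \<delta> A + hausdorff2_outer B \<le> hausdorff2_outer (A \<union> B)"
    if "0 < \<delta>" for \<delta>
    using that unfolding hausdorff2_outer_def[of B]
    by (subst ennreal_SUP_add_right) (auto intro!: SUP_least intro: exI[of _ 1])
  then show ?thesis
    unfolding hausdorff2_outer_def[of A]
    by (subst ennreal_SUP_add_left[symmetric]) (auto intro!: SUP_least intro: exI[of _ 1])
qed

lemma closed_in_lambda_system_hausdorff2:
  fixes C :: "'a::metric_space set"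
  assumes "closed C"
  shows "C \<in> lambda_system UNIV UNIV hausdorff2_outer"
proof (cases "C = {}")
  case True then show ?thesis by (simp add: lambda_system_def)
next
  case ne: False
  let ?H = "hausdorff2_outer :: 'a set \<Rightarrow> ennreal"
  have le: "?H (C \<inter> X) + ?H (X - C) \<le> ?H X" for X
  proof (cases "?H X = \<infinity>")
    case False
    define Y where "Y n = {x\<in>X. 1 / real (Suc n) \<le> infdist x C}" for n :: nat
    define R where "R n = Y (Suc n) - Y n" for n
    have gap: "a - b \<le> dist x y" if "a \<le> infdist x C" "infdist y C \<le> b" for a b x y
      using infdist_triangle[of x C y] that by linarith
    have YX: "Y n \<subseteq> X" for n by (auto simp: Y_def)
    have Ymono: "Y m \<subseteq> Y n" if "m \<le> n" for m n
    proof
      fix x assume x: "x \<in> Y m"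
      have "1 / real (Suc n) \<le> 1 / real (Suc m)" using that by (simp add: frac_le)
      with x show "x \<in> Y n" by (auto simp: Y_def)
    qed
    have "R m \<subseteq> Y n" if "Suc m \<le> n" for m n
      using Ymono[OF that] by (auto simp: R_def)
    have Rsum1: "(\<Sum>i<n. ?H (R (2 * i + c))) \<le> ?H (\<Union>i<n. R (2 * i + c))" for n c
    proof (induction n)
      case (Suc n)
      have "?H (\<Union>i<n. R (2 * i + c)) + ?H (R (2 * n + c))
          \<le> ?H ((\<Union>i<n. R (2 * i + c)) \<union> R (2 * n + c))"
      proof (cases "n = 0")
        case n: False
        have "1 / real (2 * n + c) - 1 / real (2 * n + c + 1) > 0"
          using n by (simp add: frac_less2)
        then show ?thesis
        proof (rule hausdorff2_outer_separated)
          fix a b assume "a \<in> (\<Union>i<n. R (2 * i + c))" "b \<in> R (2 * n + c)"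
          then obtain i where i: "i < n" "a \<in> R (2 * i + c)" by auto
          have "R (2 * i + c) \<subseteq> Y (2 * i + c + 1)" by (auto simp: R_def)
          also have "\<dots> \<subseteq> Y (2 * n + c - 1)" using i by (intro Ymono) linarith
          finally have "a \<in> Y (2 * n + c - 1)" using i by auto
          moreover have "Suc (2 * n + c - 1) = 2 * n + c" using n by linarith
          ultimately have "1 / real (2 * n + c) \<le> infdist a C"
            by (metis (mono_tags, lifting) Y_def mem_Collect_eq)
          moreover have "infdist b C \<le> 1 / real (2 * n + c + 1)"
            using \<open>b \<in> R (2 * n + c)\<close> by (auto simp: R_def Y_def)
          ultimately show "1 / real (2 * n + c) - 1 / real (2 * n + c + 1) \<le> dist a b"
            by (rule gap)
        qed
      qed simp
      also have "(\<Union>i<n. R (2 * i + c)) \<union> R (2 * n + c) = (\<Union>i<Suc n. R (2 * i + c))"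
        by (auto simp: less_Suc_eq)
      finally show ?case
        using Suc.IH by (simp add: add_right_mono order_trans[OF add_right_mono])
    qed simp
    have Rsum: "(\<Sum>i<n. ?H (R (2 * i + c))) \<le> ?H X" for n c
      using Rsum1 by (rule order_trans) (use YX in \<open>auto simp: R_def intro!: hausdorff2_outer_mono\<close>)
    have "(\<Sum>i<2*n. ?H (R i)) = (\<Sum>i<n. ?H (R (2 * i + 0))) + (\<Sum>i<n. ?H (R (2 * i + 1)))" for n
      by (induction n) (auto simp: algebra_simps)
    then have S2: "(\<Sum>i<2*n. ?H (R i)) \<le> ?H X + ?H X" for n
      using add_mono[OF Rsum Rsum] by metis
    have S: "(\<Sum>i. ?H (R i)) \<le> ?H X + ?H X"
    proof (rule suminf_le_const[OF summableI])
      fix n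
      have "(\<Sum>i<n. ?H (R i)) \<le> (\<Sum>i<2*n. ?H (R i))" by (intro sum_mono2) auto
      with S2 show "(\<Sum>i<n. ?H (R i)) \<le> ?H X + ?H X" by (rule order_trans[rotated])
    qed
    then have fin: "(\<Sum>i. ?H (R i)) < top"
      using False by (metis ennreal_add_eq_top infinity_ennreal_def top.not_eq_extremum top_unique)
    define r where "r i = enn2real (?H (R i))" for i
    have r: "?H (R i) = ennreal (r i)" "0 \<le> r i" for i
    proof -
      have "?H (R i) \<noteq> top" using ennreal_suminf_lessD[OF fin, of i] by simp
      then show "?H (R i) = ennreal (r i)" by (simp add: r_def less_top)
    qed (simp add: r_def)
    have sr: "summable r"
      using fin r by (intro summable_suminf_not_top) auto
    show ?thesis
    proof (rule ennreal_le_epsilon)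
      fix e :: real assume "0 < e"
      then obtain N where N: "norm (\<Sum>i. r (i + N)) < e"
        using suminf_exist_split[OF _ sr] by blast
      have tail: "(\<Sum>i. ?H (R (i + N))) \<le> ennreal e"
      proof -
        have "(\<Sum>i. ?H (R (i + N))) = ennreal (\<Sum>i. r (i + N))"
          unfolding r(1) using r(2) sr by (intro suminf_ennreal2) (auto simp: summable_iff_shift)
        with N show ?thesis by (auto intro!: ennreal_leI)
      qed
      have cov: "X - C \<subseteq> Y N \<union> (\<Union>i. R (i + N))"
      proof
        fix x assume x: "x \<in> X - C"
        then have "infdist x C \<noteq> 0"
          using in_closed_iff_infdist_zero[OF assms ne] by auto
        then have "0 < infdist x C" using infdist_nonneg[of x C] by linarith
        then obtain m where "1 / real (Suc m) < infdist x C"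
          using nat_approx_posE by metis
        then have "x \<in> Y m" using x by (auto simp: Y_def)
        show "x \<in> Y N \<union> (\<Union>i. R (i + N))"
        proof (cases "x \<in> Y N")
          case xN: False
          define k where "k = (LEAST k. x \<in> Y k)"
          have k: "x \<in> Y k" using \<open>x \<in> Y m\<close> unfolding k_def by (rule LeastI)
          have "N < k" using k xN Ymono[of k N] by (metis not_le subsetD)
          then obtain j where j: "k = Suc (j + N)"
            by (metis add.commute add_Suc_right less_iff_Suc_add)
          have "x \<notin> Y (j + N)" using not_less_Least[of "j + N" "\<lambda>k. x \<in> Y k"] j
            by (simp add: k_def)
          with k j have "x \<in> R (j + N)" by (simp add: R_def)
          then show ?thesis by auto
        qed auto
      qed
      have "?H (X - C) \<le> ?H (Y N) + ?H (\<Union>i. R (i + N))"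
        using hausdorff2_outer_mono[OF cov] hausdorff2_outer_Un by (rule order_trans)
      also have "\<dots> \<le> ?H (Y N) + ennreal e"
        using order_trans[OF hausdorff2_outer_UN tail] by (intro add_left_mono)
      finally have "?H (C \<inter> X) + ?H (X - C) \<le> (?H (C \<inter> X) + ?H (Y N)) + ennreal e"
        by (metis add.assoc add_left_mono)
      also have "?H (C \<inter> X) + ?H (Y N) \<le> ?H ((C \<inter> X) \<union> Y N)"
      proof (rule hausdorff2_outer_separated)
        show "0 < 1 / real (Suc N)" by simp
        fix a b assume "a \<in> C \<inter> X" "b \<in> Y N"
        then show "1 / real (Suc N) \<le> dist a b"
          using infdist_le[of a C b] by (auto simp: Y_def dist_commute)
      qed
      also have "\<dots> \<le> ?H X" by (intro hausdorff2_outer_mono) (auto simp: Y_def)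
      finally show "?H (C \<inter> X) + ?H (X - C) \<le> ?H X + ennreal e"
        by (simp add: add_right_mono)
    qed
  qed simp
  have "?H X \<le> ?H (C \<inter> X) + ?H (X - C)" for X
    using hausdorff2_outer_Un[of "C \<inter> X" "X - C"] by (metis Int_Diff_Un Int_commute)
  with le show ?thesis
    by (auto simp: lambda_system_def Diff_eq Int_commute intro: antisym)
qed

lemma sets_hausdorff2 [simp, measurable_cong]: "sets hausdorff2 = sets borel"
  by (simp add: hausdorff2_def sets.sigma_sets_eq[of borel, simplified])

lemma space_hausdorff2 [simp]: "space hausdorff2 = UNIV"
  by (simp add: hausdorff2_def)

theorem emeasure_hausdorff2:
  assumes "A \<in> sets borel"
  shows "emeasure hausdorff2 A = hausdorff2_outer A"
proof -
  interpret sigma_algebra UNIV "UNIV :: 'a set set"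
    using sigma_algebra_Pow[of "UNIV :: 'a set"] by simp
  let ?L = "lambda_system UNIV UNIV (hausdorff2_outer :: 'a set \<Rightarrow> ennreal)"
  have L: "measure_space UNIV ?L hausdorff2_outer"
    by (rule caratheodory_lemma[OF outer_measure_space_hausdorff2])
  have "sigma_sets UNIV {C :: 'a set. closed C} \<subseteq> ?L"
    using L closed_in_lambda_system_hausdorff2
    by (intro sigma_algebra.sigma_sets_subset) (auto simp: measure_space_def)
  then have sub: "sets (borel :: 'a measure) \<subseteq> ?L"
    by (simp add: borel_eq_closed)
  have "countably_additive (sets (borel :: 'a measure)) hausdorff2_outer"
    using L sub by (auto simp: measure_space_def countably_additive_def)
  then show ?thesis
    unfolding hausdorff2_def using assms sets.sigma_algebra_axioms[of "borel :: 'a measure"]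
    by (intro emeasure_measure_of_sigma) (auto simp: positive_def)
qed


definition surface_measure :: "(real^3) set \<Rightarrow> (real^3) measure" where
  "surface_measure \<Omega> = restrict_space hausdorff2 (frontier \<Omega>)"


section \<open>Domains, fields and their derivatives up to the boundary\<close>

definition bounded_domain :: "(real^3) set \<Rightarrow> bool" where
  "bounded_domain \<Omega> \<longleftrightarrow> \<Omega> \<noteq> {} \<and> open \<Omega> \<and> connected \<Omega> \<and> bounded \<Omega>"

text \<open>
  The \<open>j\<close>-th component of \<open>nabla f x\<close> is the partial derivative \<open>\<partial>\<^sub>j f(x)\<close>; thus
  \<open>nabla u x $ j $ i\<close> is \<open>\<partial>\<^sub>j u\<^sub>i(x)\<close>, and iterating \<open>nabla\<close> gives the arrays of
  higher derivatives.
\<close>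

definition nabla :: "(real^3 \<Rightarrow> 'b::real_normed_vector) \<Rightarrow> real^3 \<Rightarrow> 'b^3" where
  "nabla f x = (\<chi> j. frechet_derivative f (at x) (axis j 1))"

text \<open>On the boundary the derivatives are the continuous extensions from the interior.\<close>

definition nabla_closure ::
    "(real^3) set \<Rightarrow> (real^3 \<Rightarrow> 'b::real_normed_vector) \<Rightarrow> real^3 \<Rightarrow> 'b^3" where
  "nabla_closure \<Omega> f x = (if x \<in> \<Omega> then nabla f x else Lim (at x within \<Omega>) (nabla f))"

text \<open>
  For open \<open>\<Omega>\<close>, continuity of \<open>nabla_closure \<Omega> f\<close> on the closure says that the gradient is
  continuous on \<open>\<Omega>\<close> and extends continuously to the closure, so this is the usual space
  \<open>C\<^sup>1\<close> of the closure.
\<close>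

definition C1_closure :: "(real^3) set \<Rightarrow> (real^3 \<Rightarrow> 'b::real_normed_vector) \<Rightarrow> bool" where
  "C1_closure \<Omega> f \<longleftrightarrow>
     f differentiable_on \<Omega> \<and> continuous_on (closure \<Omega>) f \<and>
     continuous_on (closure \<Omega>) (nabla_closure \<Omega> f)"

definition C3_closure :: "(real^3) set \<Rightarrow> (real^3 \<Rightarrow> 'b::real_normed_vector) \<Rightarrow> bool" where
  "C3_closure \<Omega> f \<longleftrightarrow>
     C1_closure \<Omega> f \<and> C1_closure \<Omega> (nabla_closure \<Omega> f) \<and>
     C1_closure \<Omega> (nabla_closure \<Omega> (nabla_closure \<Omega> f))"

text \<open>The tuple \<open>(T, \<nabla>T, u, \<nabla>u, \<nabla>\<^sup>2u, \<nabla>\<^sup>3u)\<close> of local state variables.\<close>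

type_synonym local_state =
  "real \<times> (real^3) \<times> (real^3) \<times> (real^3^3) \<times> (real^3^3^3) \<times> (real^3^3^3^3)"

definition local_state ::
    "(real^3) set \<Rightarrow> (real^3 \<Rightarrow> real^3) \<Rightarrow> (real^3 \<Rightarrow> real) \<Rightarrow> real^3 \<Rightarrow> local_state" where
  "local_state \<Omega> u T x =
     (let D1 = nabla_closure \<Omega> u; D2 = nabla_closure \<Omega> D1; D3 = nabla_closure \<Omega> D2
      in (T x, nabla_closure \<Omega> T x, u x, D1 x, D2 x, D3 x))"


section \<open>Crack initiation intensity and objective functional\<close>

type_synonym intensity_density = "real \<Rightarrow> real^3 \<Rightarrow> local_state \<Rightarrow> real"

definition admissible_density :: "intensity_density \<Rightarrow> bool" where
  "admissible_density \<rho> \<longleftrightarrow>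
     (\<forall>t\<ge>0. \<forall>x s. 0 \<le> \<rho> t x s) \<and> (\<lambda>(t, x, s). \<rho> t x s) \<in> borel_measurable borel"

definition state_space :: "(real^3) set \<Rightarrow> (real \<times> (real^3)) set" where
  "state_space \<Omega> = {0..} \<times> closure \<Omega>"

text \<open>
  The product measures are taken in the order \<open>dx dt\<close> and \<open>dA dt\<close>: with the \<open>\<sigma>\<close>-finite
  factor \<^const>\<open>lborel\<close> in the second place they are well-behaved even if no finiteness of the
  boundary area is assumed. Elements of the measurable set \<open>C\<close> are pairs \<open>(t, x)\<close> with
  \<open>t \<ge> 0\<close>.
\<close>

definition crack_intensity ::
    "intensity_density \<Rightarrow> intensity_density \<Rightarrow> (real^3) set \<Rightarrow> (real^3 \<Rightarrow> real^3) \<Rightarrow>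
     (real^3 \<Rightarrow> real) \<Rightarrow> (real \<times> (real^3)) set \<Rightarrow> ennreal" where
  "crack_intensity \<rho>vol \<rho>sur \<Omega> u T C =
     (\<integral>\<^sup>+(x, t). ennreal (\<rho>vol t x (local_state \<Omega> u T x)) * indicator (C \<inter> (UNIV \<times> \<Omega>)) (t, x)
        \<partial>(restrict_space lborel \<Omega> \<Otimes>\<^sub>M lborel)) +
     (\<integral>\<^sup>+(x, t). ennreal (\<rho>sur t x (local_state \<Omega> u T x)) *
          indicator (C \<inter> (UNIV \<times> frontier \<Omega>)) (t, x)
        \<partial>(surface_measure \<Omega> \<Otimes>\<^sub>M lborel))"

definition cumulated :: "intensity_density \<Rightarrow> real \<Rightarrow> real^3 \<Rightarrow> local_state \<Rightarrow> ennreal" where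
  "cumulated \<rho> t x s = (\<integral>\<^sup>+r\<in>{0..t}. ennreal (\<rho> r x s) \<partial>lborel)"

definition objective ::
    "intensity_density \<Rightarrow> intensity_density \<Rightarrow> real \<Rightarrow> (real^3) set \<Rightarrow> (real^3 \<Rightarrow> real^3) \<Rightarrow>
     (real^3 \<Rightarrow> real) \<Rightarrow> ennreal" where
  "objective \<rho>vol \<rho>sur t \<Omega> u T =
     (\<integral>\<^sup>+x\<in>\<Omega>. cumulated \<rho>vol t x (local_state \<Omega> u T x) \<partial>lborel) +
     (\<integral>\<^sup>+x. cumulated \<rho>sur t x (local_state \<Omega> u T x) \<partial>surface_measure \<Omega>)"


section \<open>Poisson point processes\<close>

definition radon_measure_on :: "'a::topological_space set \<Rightarrow> 'a measure \<Rightarrow> bool" where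
  "radon_measure_on S \<mu> \<longleftrightarrow>
     sets \<mu> = sets (restrict_space borel S) \<and>
     (\<forall>K. compact K \<and> K \<subseteq> S \<longrightarrow> emeasure \<mu> K < \<infinity>) \<and>
     (\<forall>B\<in>sets \<mu>. emeasure \<mu> B = (SUP K\<in>{K. compact K \<and> K \<subseteq> B}. emeasure \<mu> K))"

definition counting_measure :: "'a measure \<Rightarrow> bool" where
  "counting_measure \<mu> \<longleftrightarrow> (\<forall>B\<in>sets \<mu>. emeasure \<mu> B \<in> range ennreal_of_enat)"

text \<open>As usual, a Poisson variable with infinite mean is almost surely infinite.\<close>

definition poisson_distributed :: "'w measure \<Rightarrow> ('w \<Rightarrow> ennreal) \<Rightarrow> ennreal \<Rightarrow> bool" where
  "poisson_distributed M X m \<longleftrightarrow>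
     (if m = \<infinity> then AE \<omega> in M. X \<omega> = \<infinity>
      else \<forall>n::nat. measure M {\<omega>\<in>space M. X \<omega> = of_nat n} =
             enn2real m ^ n / fact n * exp (- enn2real m))"

definition poisson_point_process ::
    "'w measure \<Rightarrow> 'a::topological_space set \<Rightarrow> 'a measure \<Rightarrow> ('w \<Rightarrow> 'a measure) \<Rightarrow> bool" where
  "poisson_point_process M S \<rho> \<gamma> \<longleftrightarrow>
     (\<forall>\<omega>\<in>space M. radon_measure_on S (\<gamma> \<omega>) \<and> counting_measure (\<gamma> \<omega>)) \<and>
     (\<forall>C\<in>sets (restrict_space borel S). (\<lambda>\<omega>. emeasure (\<gamma> \<omega>) C) \<in> borel_measurable M) \<and>
     (\<forall>(I::nat set) C. finite I \<longrightarrow> (\<forall>i\<in>I. C i \<in> sets (restrict_space borel S)) \<longrightarrow>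
        disjoint_family_on C I \<longrightarrow>
        prob_space.indep_vars M (\<lambda>_. borel) (\<lambda>i \<omega>. emeasure (\<gamma> \<omega>) (C i)) I) \<and>
     (\<forall>C\<in>sets (restrict_space borel S).
        poisson_distributed M (\<lambda>\<omega>. emeasure (\<gamma> \<omega>) C) (emeasure \<rho> C))"


section \<open>First failure time and notions of reliability\<close>

text \<open>The infimum is taken in \<^typ>\<open>ereal\<close>: a design that never fails has \<open>\<tau> = \<infinity>\<close>.\<close>

definition first_failure_time ::
    "(real^3) set \<Rightarrow> ('w \<Rightarrow> (real \<times> (real^3)) measure) \<Rightarrow> 'w \<Rightarrow> ereal" where
  "first_failure_time \<Omega> \<gamma> \<omega> =
     Inf {ereal t |t. 0 \<le> t \<and> 0 < emeasure (\<gamma> \<omega>) ({0..t} \<times> closure \<Omega>)}"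

definition failure_cdf :: "'w measure \<Rightarrow> ('w \<Rightarrow> ereal) \<Rightarrow> real \<Rightarrow> real" where
  "failure_cdf M \<tau> t = measure M {\<omega>\<in>space M. \<tau> \<omega> \<le> ereal t}"

text \<open>
  \<open>f\<close> is a density of \<open>\<tau>\<close> on the real line (an atom at \<open>\<infinity>\<close> is permitted). Densities are
  only determined up to null sets, whereas hazard rates are compared at every single \<open>t\<close>; the
  last conjunct fixes the version of the density that is the derivative of the distribution
  function at each \<open>t \<ge> 0\<close> (one-sided at \<open>0\<close>). In particular, any density that is continuous
  on the nonnegative half-line qualifies.
\<close>

definition continuously_distributed ::
    "'w measure \<Rightarrow> ('w \<Rightarrow> ereal) \<Rightarrow> (real \<Rightarrow> real) \<Rightarrow> bool" where
  "continuously_distributed M \<tau> f \<longleftrightarrow>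
     f \<in> borel_measurable borel \<and> (\<forall>t. 0 \<le> f t) \<and>
     (\<forall>A\<in>sets borel. emeasure M {\<omega>\<in>space M. \<tau> \<omega> \<in> ereal ` A} = (\<integral>\<^sup>+t\<in>A. ennreal (f t) \<partial>lborel)) \<and>
     (\<forall>t\<ge>0. (failure_cdf M \<tau> has_real_derivative f t) (at t within {0..}))"

definition hazard_rate :: "'w measure \<Rightarrow> ('w \<Rightarrow> ereal) \<Rightarrow> (real \<Rightarrow> real) \<Rightarrow> real \<Rightarrow> real" where
  "hazard_rate M \<tau> f t = f t / (1 - failure_cdf M \<tau> t)"

definition reliable_at ::
    "'w measure \<Rightarrow> real \<Rightarrow> ('w \<Rightarrow> ereal) \<Rightarrow> ('w \<Rightarrow> ereal) \<Rightarrow> bool" where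
  "reliable_at M t \<tau> \<tau>' \<longleftrightarrow> failure_cdf M \<tau> t \<le> failure_cdf M \<tau>' t"

definition reliable_stochastic_order ::
    "'w measure \<Rightarrow> ('w \<Rightarrow> ereal) \<Rightarrow> ('w \<Rightarrow> ereal) \<Rightarrow> bool" where
  "reliable_stochastic_order M \<tau> \<tau>' \<longleftrightarrow> (\<forall>t\<ge>0. failure_cdf M \<tau> t \<le> failure_cdf M \<tau>' t)"

definition reliable_hazard ::
    "'w measure \<Rightarrow> ('w \<Rightarrow> ereal) \<Rightarrow> (real \<Rightarrow> real) \<Rightarrow> ('w \<Rightarrow> ereal) \<Rightarrow> (real \<Rightarrow> real) \<Rightarrow> bool" where
  "reliable_hazard M \<tau> f \<tau>' f' \<longleftrightarrow> (\<forall>t\<ge>0. hazard_rate M \<tau> f t \<le> hazard_rate M \<tau>' f' t)"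

definition optimal_reliability :: "('d \<Rightarrow> 'd \<Rightarrow> bool) \<Rightarrow> 'd set \<Rightarrow> 'd \<Rightarrow> bool" where
  "optimal_reliability more_reliable \<O> \<Omega>' \<longleftrightarrow>
     \<Omega>' \<in> \<O> \<and> (\<forall>\<Omega>\<in>\<O>. more_reliable \<Omega>' \<Omega>)"

end

theory Submission
  imports Defs
begin

text \<open>
  The failure time satisfies \<open>\<tau> \<le> t\<close> precisely when the configuration charges
  \<open>[0,t] \<times> closure \<Omega>\<close>: a Radon counting measure is integer valued and finite on these compact
  sets, so it cannot charge all \<open>[0,s] \<times> closure \<Omega>\<close> with \<open>s > t\<close> without charging their
  intersection. By Tonelli the intensity of \<open>[0,t] \<times> closure \<Omega>\<close> is \<open>J\<^sub>t\<close>, which is finite.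
  Hence \<open>F(t) = 1 - exp (- J\<^sub>t)\<close> is strictly increasing in \<open>J\<^sub>t\<close>, and \<open>J\<^sub>t = - ln (1 - F(t))\<close> has
  the hazard rate as its derivative.
\<close>

lemma continuous_on_local_state:
  assumes "C1_closure \<Omega> T" "C3_closure \<Omega> u"
  shows "continuous_on (closure \<Omega>) (local_state \<Omega> u T)"
  using assms unfolding local_state_def[abs_def] Let_def C3_closure_def C1_closure_def
  by (intro continuous_on_Pair) auto

text \<open>Tonelli, stated for an arbitrary measure \<open>N\<close> on \<open>S\<close> so that it
  serves both the volume part and the surface part of the intensity. Only the time factor, which is
  integrated first, has to be sigma-finite; nothing of the kind is asked of the area measure on the
  boundary.\<close>

lemma nn_integral_time_slab:
  assumes \<rho>: "admissible_density \<rho>"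
    and L: "continuous_on (closure \<Omega>) L"
    and N: "sets N = sets (restrict_space borel S)"
    and S: "S \<subseteq> closure \<Omega>"
  shows "(\<integral>\<^sup>+(x, r). ennreal (\<rho> r x (L x)) *
            indicator ({0..t} \<times> closure \<Omega> \<inter> UNIV \<times> S) (r, x) \<partial>(N \<Otimes>\<^sub>M lborel)) =
         (\<integral>\<^sup>+x. cumulated \<rho> t x (L x) \<partial>N)"
proof -
  have space_N: "space N = S"
    using sets_eq_imp_space_eq[OF N] by (simp add: space_restrict_space)
  \<comment> \<open>Continuity up to the boundary is what makes the local state measurable for a
    measure living on the boundary as well as for one on the interior.\<close>
  have L_N [measurable]: "L \<in> borel_measurable N"
    using borel_measurable_continuous_on_restrict[OF continuous_on_subset[OF L S]]
    by (simp cong: measurable_cong_sets add: measurable_cong_sets[OF N refl])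
  have id_N [measurable]: "(\<lambda>x. x) \<in> borel_measurable N"
    using borel_measurable_continuous_on_restrict[OF continuous_on_id[of S]]
    by (simp add: measurable_cong_sets[OF N refl])
  have \<rho>_borel: "(\<lambda>(r, x, s). \<rho> r x s) \<in> borel_measurable borel"
    using \<rho> by (simp add: admissible_density_def)
  \<comment> \<open>The map (x, r) \<mapsto> (r, x, L x) swaps space and time and inserts the state,
    so that the jointly Borel density can be composed with it.\<close>
  have "(\<lambda>p. (snd p, fst p, L (fst p))) \<in> borel_measurable (N \<Otimes>\<^sub>M lborel)"
    by (intro borel_measurable_Pair) measurable
  from measurable_compose[OF this \<rho>_borel]
  have [measurable]: "(\<lambda>p. \<rho> (snd p) (fst p) (L (fst p))) \<in> borel_measurable (N \<Otimes>\<^sub>M lborel)"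
    by simp
  \<comment> \<open>Points of \<open>N\<close> lie in \<open>S\<close>, hence in the closure of
    \<Omega>: the spatial constraints of the indicator hold automatically and only the time window
    is left.\<close>
  have "(\<integral>\<^sup>+(x, r). ennreal (\<rho> r x (L x)) *
            indicator ({0..t} \<times> closure \<Omega> \<inter> UNIV \<times> S) (r, x) \<partial>(N \<Otimes>\<^sub>M lborel)) =
      (\<integral>\<^sup>+p. ennreal (\<rho> (snd p) (fst p) (L (fst p))) * indicator {0..t} (snd p) \<partial>(N \<Otimes>\<^sub>M lborel))"
    using S by (intro nn_integral_cong)
      (auto simp: space_pair_measure space_N split: split_indicator)
  also have "\<dots> = (\<integral>\<^sup>+x. \<integral>\<^sup>+r. ennreal (\<rho> r x (L x)) * indicator {0..t} r \<partial>lborel \<partial>N)"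
    by (subst lborel.nn_integral_fst[symmetric]) auto
  finally show ?thesis by (simp add: cumulated_def)
qed

text \<open>Two instances of the Tonelli identity, with \<open>S\<close> equal to \<Omega> and to
  its frontier. Openness of \<Omega> makes it Borel, so that integrating against the restricted
  Lebesgue measure becomes a set integral over \<Omega>.\<close>

lemma crack_intensity_time_slab:
  assumes "bounded_domain \<Omega>" "C1_closure \<Omega> T" "C3_closure \<Omega> u"
    and "admissible_density \<rho>vol" "admissible_density \<rho>sur"
  shows "crack_intensity \<rho>vol \<rho>sur \<Omega> u T ({0..t} \<times> closure \<Omega>) = objective \<rho>vol \<rho>sur t \<Omega> u T"
proof -
  note slab = nn_integral_time_slab[OF _ continuous_on_local_state[OF assms(2,3)]]
  have "\<Omega> \<in> sets borel"
    using assms(1) by (simp add: bounded_domain_def)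
  moreover have "sets (restrict_space lborel \<Omega>) = sets (restrict_space borel \<Omega>)"
    "sets (surface_measure \<Omega>) = sets (restrict_space borel (frontier \<Omega>))"
    by (simp_all add: sets_restrict_space surface_measure_def)
  ultimately show ?thesis
    using assms(4,5) closure_subset[of \<Omega>]
    by (simp add: crack_intensity_def objective_def slab nn_integral_restrict_space frontier_def)
qed

lemma time_slab_measurable:
  "{0..t} \<times> closure \<Omega> \<in> sets (restrict_space borel (state_space \<Omega>))"
proof -
  have "{0..t} \<times> closure \<Omega> = state_space \<Omega> \<inter> {0..t} \<times> closure \<Omega>"
    by (auto simp: state_space_def)
  moreover have "{0..t} \<times> closure \<Omega> \<in> sets borel"
    by (intro borel_closed closed_Times) auto
  ultimately show ?thesis
    unfolding sets_restrict_space by (rule image_eqI)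
qed

text \<open>The infimum defining the failure time may be tested at \<open>t\<close> itself, because
  the mass of the slab is right-continuous in \<open>t\<close> and takes no values strictly between
  0 and 1.\<close>

lemma radon_counting_measure_cylinder:
  assumes rad: "radon_measure_on (state_space \<Omega>) \<mu>" and cnt: "counting_measure \<mu>"
    and bdd: "bounded \<Omega>" and t: "0 \<le> t"
  shows "Inf {ereal s |s. 0 \<le> s \<and> 0 < emeasure \<mu> ({0..s} \<times> closure \<Omega>)} \<le> ereal t \<longleftrightarrow>
    0 < emeasure \<mu> ({0..t} \<times> closure \<Omega>)"
proof
  let ?S = "\<lambda>s::real. {0..s} \<times> closure \<Omega>"
  let ?A = "{ereal s |s. 0 \<le> s \<and> 0 < emeasure \<mu> (?S s)}"
  have cpt: "compact (?S s)" for s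
    using bdd by (intro compact_Times) auto
  have sub: "?S s \<subseteq> state_space \<Omega>" for s
    by (auto simp: state_space_def)
  have sets: "?S s \<in> sets \<mu>" for s
    using rad time_slab_measurable by (simp add: radon_measure_on_def)
  \<comment> \<open>Compactness gives finite mass, which continuity from above requires
    later.\<close>
  have fin: "emeasure \<mu> (?S s) < \<infinity>" for s
    using rad cpt sub by (auto simp: radon_measure_on_def)
  show "Inf ?A \<le> ereal t" if "0 < emeasure \<mu> (?S t)"
    using that t by (intro Inf_lower) auto
  assume Inf_le: "Inf ?A \<le> ereal t"
  \<comment> \<open>Some time \<open>r\<close> before \<open>s\<close> already carries mass. Being
    integer valued, that mass yields the bound 1, uniform in \<open>s\<close>, and such a bound
    survives the limit as \<open>s\<close> decreases to \<open>t\<close>; mere positivity would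
    not.\<close>
  have ge1: "1 \<le> emeasure \<mu> (?S s)" if "t < s" for s
  proof -
    have "Inf ?A < ereal s" using Inf_le that by (simp add: order.strict_trans1)
    then obtain r where r: "r < s" "0 < emeasure \<mu> (?S r)"
      by (auto simp: Inf_less_iff)
    have "emeasure \<mu> (?S r) \<le> emeasure \<mu> (?S s)"
      using r(1) by (intro emeasure_mono sets) auto
    with r(2) have pos: "0 < emeasure \<mu> (?S s)" by order
    obtain k where k: "emeasure \<mu> (?S s) = ennreal_of_enat k"
      using cnt sets unfolding counting_measure_def by blast
    with pos have "1 \<le> k"
      by (metis ennreal_of_enat_0 ileI1 less_irrefl one_eSuc zero_less_iff_neq_zero)
    then show ?thesis
      using k by (metis ennreal_of_enat_1 ennreal_of_enat_le_iff)
  qed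
  let ?D = "\<lambda>n::nat. ?S (t + 1 / real (Suc n))"
  have "(\<Inter>n. ?D n) = ?S t"
  proof (intro equalityI subsetI)
    fix p assume p: "p \<in> (\<Inter>n. ?D n)"
    have "fst p \<le> t"
    proof (rule field_le_epsilon)
      fix e :: real assume "0 < e"
      then obtain n where "1 / real (Suc n) < e" using nat_approx_posE by metis
      moreover have "fst p \<le> t + 1 / real (Suc n)" using p by auto
      ultimately show "fst p \<le> t + e" by simp
    qed
    with p show "p \<in> ?S t" by auto
  next
    fix p assume "p \<in> ?S t"
    moreover have "t \<le> t + 1 / real (Suc n)" for n by simp
    ultimately show "p \<in> (\<Inter>n. ?D n)" by (fastforce intro: order_trans)
  qed
  moreover have "decseq ?D"
    unfolding decseq_def by (intro allI impI Sigma_mono) (simp_all add: frac_le)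
  ultimately have "(INF n. emeasure \<mu> (?D n)) = emeasure \<mu> (?S t)"
    using sets fin by (subst INF_emeasure_decseq) (auto simp: less_top)
  moreover have "1 \<le> (INF n. emeasure \<mu> (?D n))"
    by (intro INF_greatest ge1) simp
  ultimately show "0 < emeasure \<mu> (?S t)"
    by (metis less_le_trans zero_less_one)
qed

text \<open>Survival past \<open>t\<close> is the void event that the slab contains no point. Its
  probability is the Poisson weight at \<open>n = 0\<close>; finiteness of the intensity excludes
  the infinite-mean case.\<close>

lemma failure_cdf_eq:
  assumes "prob_space P" "bounded_domain \<Omega>" and t: "0 \<le> t"
    and pp: "poisson_point_process P (state_space \<Omega>) \<rho> \<gamma>"
    and fin: "emeasure \<rho> ({0..t} \<times> closure \<Omega>) < \<infinity>"
  shows "failure_cdf P (first_failure_time \<Omega> \<gamma>) t =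
    1 - exp (- enn2real (emeasure \<rho> ({0..t} \<times> closure \<Omega>)))"
proof -
  interpret prob_space P by fact
  let ?S = "{0..t} \<times> closure \<Omega>"
  let ?Z = "{\<omega>\<in>space P. emeasure (\<gamma> \<omega>) ?S = 0}"
  have config: "radon_measure_on (state_space \<Omega>) (\<gamma> \<omega>)" "counting_measure (\<gamma> \<omega>)"
    if "\<omega> \<in> space P" for \<omega>
    using pp that by (simp_all add: poisson_point_process_def)
  have meas [measurable]: "(\<lambda>\<omega>. emeasure (\<gamma> \<omega>) ?S) \<in> borel_measurable P"
    and pois: "poisson_distributed P (\<lambda>\<omega>. emeasure (\<gamma> \<omega>) ?S) (emeasure \<rho> ?S)"
    using pp time_slab_measurable[of t \<Omega>] by (simp_all add: poisson_point_process_def)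
  from pois fin have "prob {\<omega>\<in>space P. emeasure (\<gamma> \<omega>) ?S = of_nat n} =
      enn2real (emeasure \<rho> ?S) ^ n / fact n * exp (- enn2real (emeasure \<rho> ?S))" for n
    by (simp add: poisson_distributed_def less_top)
  from this[of 0] have prob_Z: "prob ?Z = exp (- enn2real (emeasure \<rho> ?S))"
    by simp
  have "first_failure_time \<Omega> \<gamma> \<omega> \<le> ereal t \<longleftrightarrow> emeasure (\<gamma> \<omega>) ?S \<noteq> 0" if "\<omega> \<in> space P" for \<omega>
    using radon_counting_measure_cylinder[OF config[OF that] _ t] assms(2)
    by (simp add: first_failure_time_def bounded_domain_def zero_less_iff_neq_zero)
  then have "{\<omega>\<in>space P. first_failure_time \<Omega> \<gamma> \<omega> \<le> ereal t} = space P - ?Z"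
    by blast
  moreover have "?Z \<in> events" by measurable
  ultimately show ?thesis
    unfolding failure_cdf_def by (simp only: prob_compl prob_Z)
qed

text \<open>Here \<open>J\<close> is the cumulative hazard \<open>- ln (1 - F)\<close>, and the
  chain rule gives \<open>f / (1 - F)\<close>. Derivatives are taken within \<open>{0..}\<close>
  since the formula for \<open>F\<close> is available only there.\<close>

lemma vector_derivative_cumulative_hazard:
  assumes "continuously_distributed M \<tau> f"
    and cdf: "\<And>s. 0 \<le> s \<Longrightarrow> failure_cdf M \<tau> s = 1 - exp (- J s)" and t: "0 \<le> t"
  shows "vector_derivative J (at t within {0..}) = hazard_rate M \<tau> f t"
proof -
  have F: "(failure_cdf M \<tau> has_real_derivative f t) (at t within {0..})"
    using assms by (simp add: continuously_distributed_def)
  \<comment> \<open>The survival probability is an exponential, so the logarithm is differentiable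
    there and the hazard rate has a nonzero denominator.\<close>
  have pos: "0 < 1 - failure_cdf M \<tau> t" using cdf[OF t] by simp
  have "((\<lambda>s. - ln (1 - failure_cdf M \<tau> s)) has_real_derivative hazard_rate M \<tau> f t)
      (at t within {0..})"
    by (rule derivative_eq_intros F refl pos)+ (use pos in \<open>simp add: hazard_rate_def\<close>)
  \<comment> \<open>\<open>J\<close> agrees with \<open>- ln (1 - F)\<close> on all of
    \<open>{0..}\<close>, so the radius 1 is arbitrary.\<close>
  then have "(J has_real_derivative hazard_rate M \<tau> f t) (at t within {0..})"
    by (rule has_field_derivative_transform_within[where d = 1]) (use t cdf in auto)
  then have "(J has_vector_derivative hazard_rate M \<tau> f t) (at t within {0..})"
    by (simp add: has_real_derivative_iff_has_vector_derivative)
  \<comment> \<open>Uniqueness of the derivative needs \<open>t\<close> to be a limit point of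
    \<open>{0..}\<close>; approach from the right works at every \<open>t\<close>, the endpoint 0
    included.\<close>
  moreover have "at t within {0..} \<noteq> bot"
  proof -
    have "at_right t \<le> at t within {0..}" using t by (intro at_le) auto
    then show ?thesis using trivial_limit_at_right_real[of t] by (auto simp: bot_unique)
  qed
  ultimately show ?thesis
    by (intro vector_derivative_within)
qed

theorem lemma2p6:
  fixes P :: "'w measure"
    and \<O> :: "(real^3) set set"
    and T :: "(real^3) set \<Rightarrow> real^3 \<Rightarrow> real"
    and u :: "(real^3) set \<Rightarrow> real^3 \<Rightarrow> real^3"
    and \<rho>vol \<rho>sur :: intensity_density
    and \<rho> :: "(real^3) set \<Rightarrow> (real \<times> (real^3)) measure"
    and \<gamma> :: "(real^3) set \<Rightarrow> 'w \<Rightarrow> (real \<times> (real^3)) measure"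
    and \<Omega>' :: "(real^3) set"
  assumes "prob_space P"
    and "\<And>\<Omega>. \<Omega> \<in> \<O> \<Longrightarrow> bounded_domain \<Omega>"
    and "\<And>\<Omega>. \<Omega> \<in> \<O> \<Longrightarrow> C1_closure \<Omega> (T \<Omega>)"
    and "\<And>\<Omega>. \<Omega> \<in> \<O> \<Longrightarrow> C3_closure \<Omega> (u \<Omega>)"
    and "admissible_density \<rho>vol"
    and "admissible_density \<rho>sur"
    and "\<And>\<Omega>. \<Omega> \<in> \<O> \<Longrightarrow> radon_measure_on (state_space \<Omega>) (\<rho> \<Omega>)"
    and "\<And>\<Omega> C. \<Omega> \<in> \<O> \<Longrightarrow> C \<in> sets (restrict_space borel (state_space \<Omega>)) \<Longrightarrow>
           emeasure (\<rho> \<Omega>) C = crack_intensity \<rho>vol \<rho>sur \<Omega> (u \<Omega>) (T \<Omega>) C"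
    and "\<And>\<Omega>. \<Omega> \<in> \<O> \<Longrightarrow> poisson_point_process P (state_space \<Omega>) (\<rho> \<Omega>) (\<gamma> \<Omega>)"
    and "\<Omega>' \<in> \<O>"
  shows
    "(\<forall>t\<ge>0.
        optimal_reliability
          (\<lambda>\<Omega>1 \<Omega>2. reliable_at P t
             (first_failure_time \<Omega>1 (\<gamma> \<Omega>1)) (first_failure_time \<Omega>2 (\<gamma> \<Omega>2))) \<O> \<Omega>' \<longleftrightarrow>
        (\<forall>\<Omega>\<in>\<O>. objective \<rho>vol \<rho>sur t \<Omega>' (u \<Omega>') (T \<Omega>') \<le> objective \<rho>vol \<rho>sur t \<Omega> (u \<Omega>) (T \<Omega>))) \<and>
     (optimal_reliability
        (\<lambda>\<Omega>1 \<Omega>2. reliable_stochastic_order P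
           (first_failure_time \<Omega>1 (\<gamma> \<Omega>1)) (first_failure_time \<Omega>2 (\<gamma> \<Omega>2))) \<O> \<Omega>' \<longleftrightarrow>
      (\<forall>t\<ge>0. \<forall>\<Omega>\<in>\<O>.
         objective \<rho>vol \<rho>sur t \<Omega>' (u \<Omega>') (T \<Omega>') \<le> objective \<rho>vol \<rho>sur t \<Omega> (u \<Omega>) (T \<Omega>))) \<and>
     (\<forall>f. (\<forall>\<Omega>\<in>\<O>. continuously_distributed P (first_failure_time \<Omega> (\<gamma> \<Omega>)) (f \<Omega>)) \<longrightarrow>
        (optimal_reliability
           (\<lambda>\<Omega>1 \<Omega>2. reliable_hazard P
              (first_failure_time \<Omega>1 (\<gamma> \<Omega>1)) (f \<Omega>1) (first_failure_time \<Omega>2 (\<gamma> \<Omega>2)) (f \<Omega>2)) \<O> \<Omega>' \<longleftrightarrow>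
         (\<forall>t\<ge>0. \<forall>\<Omega>\<in>\<O>.
            vector_derivative (\<lambda>s. enn2real (objective \<rho>vol \<rho>sur s \<Omega>' (u \<Omega>') (T \<Omega>')))
              (at t within {0..}) \<le>
            vector_derivative (\<lambda>s. enn2real (objective \<rho>vol \<rho>sur s \<Omega> (u \<Omega>) (T \<Omega>)))
              (at t within {0..}))))"
proof -
  define J where "J \<Omega> t = objective \<rho>vol \<rho>sur t \<Omega> (u \<Omega>) (T \<Omega>)" for \<Omega> t
  define \<tau> where "\<tau> \<Omega> = first_failure_time \<Omega> (\<gamma> \<Omega>)" for \<Omega>
  have J: "emeasure (\<rho> \<Omega>) ({0..t} \<times> closure \<Omega>) = J \<Omega> t" "J \<Omega> t < \<infinity>" if \<Omega>: "\<Omega> \<in> \<O>" for \<Omega> t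
  proof -
    have cpt: "compact ({0..t} \<times> closure \<Omega>)"
      using assms(2)[OF \<Omega>] by (intro compact_Times) (auto simp: bounded_domain_def)
    have sub: "{0..t} \<times> closure \<Omega> \<subseteq> state_space \<Omega>"
      by (auto simp: state_space_def)
    show eq: "emeasure (\<rho> \<Omega>) ({0..t} \<times> closure \<Omega>) = J \<Omega> t"
      using assms(8)[OF \<Omega> time_slab_measurable]
        crack_intensity_time_slab[OF assms(2-4)[OF \<Omega>] assms(5,6)]
      by (simp add: J_def)
    \<comment> \<open>The Radon property bounds the intensity on the compact slab, so no
      integrability of the densities has to be assumed separately.\<close>
    show "J \<Omega> t < \<infinity>"
      using assms(7)[OF \<Omega>] cpt sub by (simp add: radon_measure_on_def flip: eq)
  qed
  have cdf: "failure_cdf P (\<tau> \<Omega>) t = 1 - exp (- enn2real (J \<Omega> t))" if "\<Omega> \<in> \<O>" "0 \<le> t" for \<Omega> t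
    using failure_cdf_eq[OF assms(1) assms(2)[OF that(1)] that(2) assms(9)[OF that(1)]] J[OF that(1)]
    by (simp add: \<tau>_def)
  have cdf_le: "failure_cdf P (\<tau> \<Omega>1) t \<le> failure_cdf P (\<tau> \<Omega>2) t \<longleftrightarrow> J \<Omega>1 t \<le> J \<Omega>2 t"
    if "\<Omega>1 \<in> \<O>" "\<Omega>2 \<in> \<O>" "0 \<le> t" for \<Omega>1 \<Omega>2 t
  proof -
    \<comment> \<open>Finiteness lets the extended objectives be compared through their real values;
      \<open>enn2real\<close> would send an infinite one to 0 and destroy the order.\<close>
    have "J \<Omega> t = ennreal (enn2real (J \<Omega> t))" if "\<Omega> \<in> \<O>" for \<Omega>
      using J(2)[OF that] by (simp add: ennreal_enn2real)
    then have "J \<Omega>1 t \<le> J \<Omega>2 t \<longleftrightarrow> enn2real (J \<Omega>1 t) \<le> enn2real (J \<Omega>2 t)"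
      using that by (metis enn2real_nonneg ennreal_le_iff)
    then show ?thesis using that by (simp add: cdf)
  qed
  have hazard: "vector_derivative (\<lambda>s. enn2real (J \<Omega> s)) (at t within {0..}) =
      hazard_rate P (\<tau> \<Omega>) (f \<Omega>) t"
    if "\<Omega> \<in> \<O>" "0 \<le> t" "\<forall>\<Omega>\<in>\<O>. continuously_distributed P (\<tau> \<Omega>) (f \<Omega>)" for \<Omega> t f
    using that cdf by (intro vector_derivative_cumulative_hazard) auto
  \<comment> \<open>All three equivalences are now pointwise in \<open>t\<close> and in the
    competitor: the first two compare distribution functions, the third replaces hazard rates by
    equal derivatives.\<close>
  show ?thesis
    unfolding optimal_reliability_def reliable_at_def reliable_stochastic_order_def
      reliable_hazard_def J_def[symmetric] \<tau>_def[symmetric]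
    using \<open>\<Omega>' \<in> \<O>\<close> by (auto simp: cdf_le hazard)
qed

end
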